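(* There exist absolute constants $c,C>0$ such that for every $\varepsilon>0$ there is $\lambda_\varepsilon>1$ with the following property. For every $\lambda\in(1,\lambda_\varepsilon)$ there exist a lacunary sequence $\Lambda$ of positive integers with ratio $\rho_\Lambda\in[\lambda,\lambda^3)$ and an exponent $p\in(1,2)$ with $p<1+\varepsilon$ such that $$\sup_{\substack{\|f\|_{L^p(\mathbb{T})}=1\\ f\in H^p_A(\mathbb{T})}}\big\|S^{(\Lambda)}(f)\big\|_{L^p(\mathbb{T})}\ge\frac{c}{p-1}(\lambda-1)^{-1/2}$$ and $$C^{-1}(\rho_\Lambda-1)^{-1/2}\le(\lambda-1)^{-1/2}\le C(\rho_\Lambda-1)^{-1/2}.$$
   Context: $\mathbb{T}=\mathbb{R}/(2\pi\mathbb{Z})$; $\mathbb{N}$ is the set of positive integers and $\mathbb{N}_0=\mathbb{N}\cup\{0\}$. The norm on $L^p(\mathbb{T})$ is $\|f\|_{L^p(\mathbb{T})}=\big((2\pi)^{-1}\int_{\mathbb{T}}|f|^p\big)^{1/p}$ and $\widehat f(n)=(2\pi)^{-1}\int_{\mathbb{T}}f(x)e^{-inx}dx$. For $1\le p\le\infty$, the analytic Hardy space $H^p_A(\mathbb{T})$ is the class of all $f\in L^p(\mathbb{T})$ with $\mathrm{supp}(\widehat f)\subseteq\mathbb{N}_0$. A strictly increasing sequence $\Lambda=(\lambda_j)_{j\in\mathbb{N}_0}$ of positive integers is lacunary if its ratio $\rho_\Lambda:=\inf_{j\in\mathbb{N}_0}\lambda_{j+1}/\lambda_j$ is greater than $1$.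 For $N\in\mathbb{N}$, $S_N$ is the Fourier multiplier operator on $\mathbb{T}$ with symbol $\chi_{\{-N+1,\dots,N-1\}}$, i.e. $S_N(f)(x)=\sum_{|n|\le N-1}\widehat f(n)e^{inx}$. Set $\Delta^{(\Lambda)}_0:=S_{\lambda_0}$ and $\Delta^{(\Lambda)}_j:=S_{\lambda_j}-S_{\lambda_{j-1}}$ for $j\in\mathbb{N}$. The Littlewood-Paley square function is $$S^{(\Lambda)}(f):=\Big(\sum_{j\in\mathbb{N}_0}\big|\Delta^{(\Lambda)}_j(f)\big|^2\Big)^{1/2}.$$ *)

theory Defs
  imports "HOL-Analysis.Analysis"
begin

text \<open>
  Functions on the circle \<open>\<real> / 2\<pi>\<int>\<close> are represented by \<open>2\<pi>\<close>-periodic functions on the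
  real line, integrated over one period.  Elements of \<open>L\<^sup>p\<close> are represented by functions rather than
  by classes modulo null sets: the norms, Fourier coefficients and square functions below depend
  only on the class.
\<close>

definition circle_fun :: "(real \<Rightarrow> 'a) \<Rightarrow> bool" where
  "circle_fun f \<longleftrightarrow> (\<forall>x. f (x + 2 * pi) = f x)"

text \<open>Intended for exponents \<open>a > 0\<close> only, where \<open>\<infinity>\<^sup>a = \<infinity>\<close>.\<close>

definition ennreal_powr :: "ennreal \<Rightarrow> real \<Rightarrow> ennreal" where
  "ennreal_powr x a = (if x = top then top else ennreal (enn2real x powr a))"

text \<open>
  The \<open>L\<^sup>p\<close> norm is taken of the modulus, with values in \<open>[0, \<infinity>]\<close>: a square function may be
  infinite at some points or have infinite norm.
\<close>

definition circle_Lp_norm :: "real \<Rightarrow> (real \<Rightarrow> ennreal) \<Rightarrow> ennreal" where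
  "circle_Lp_norm p g =
     ennreal_powr
       (ennreal (1 / (2 * pi)) * (\<integral>\<^sup>+x\<in>{0..2 * pi}. ennreal_powr (g x) p \<partial>lebesgue))
       (1 / p)"

abbreviation modulus :: "(real \<Rightarrow> complex) \<Rightarrow> real \<Rightarrow> ennreal" where
  "modulus f \<equiv> \<lambda>x. ennreal (cmod (f x))"

definition circle_Lp :: "real \<Rightarrow> (real \<Rightarrow> complex) set" where
  "circle_Lp p =
     {f. circle_fun f \<and> f \<in> borel_measurable lebesgue \<and> circle_Lp_norm p (modulus f) < top}"

definition fourier_coeff :: "(real \<Rightarrow> complex) \<Rightarrow> int \<Rightarrow> complex" where
  "fourier_coeff f n =
     complex_of_real (1 / (2 * pi)) *
     (LINT x:{0..2 * pi}|lebesgue. f x * exp (- (\<i> * of_int n * complex_of_real x)))"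

definition analytic_Hardy :: "real \<Rightarrow> (real \<Rightarrow> complex) set" where
  "analytic_Hardy p = {f \<in> circle_Lp p. {n. fourier_coeff f n \<noteq> 0} \<subseteq> {0..}}"

definition ratio :: "(nat \<Rightarrow> nat) \<Rightarrow> real" where
  "ratio \<Lambda> = (INF j. real (\<Lambda> (Suc j)) / real (\<Lambda> j))"

definition lacunary :: "(nat \<Rightarrow> nat) \<Rightarrow> bool" where
  "lacunary \<Lambda> \<longleftrightarrow> strict_mono \<Lambda> \<and> (\<forall>j. \<Lambda> j > 0) \<and> ratio \<Lambda> > 1"

definition partial_sum :: "nat \<Rightarrow> (real \<Rightarrow> complex) \<Rightarrow> real \<Rightarrow> complex" where
  "partial_sum N f x =
     (\<Sum>n \<in> {- int N + 1..int N - 1}. fourier_coeff f n * exp (\<i> * of_int n * complex_of_real x))"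

fun LP_block :: "(nat \<Rightarrow> nat) \<Rightarrow> nat \<Rightarrow> (real \<Rightarrow> complex) \<Rightarrow> real \<Rightarrow> complex" where
  "LP_block \<Lambda> 0 f x = partial_sum (\<Lambda> 0) f x"
| "LP_block \<Lambda> (Suc j) f x = partial_sum (\<Lambda> (Suc j)) f x - partial_sum (\<Lambda> j) f x"

definition square_function :: "(nat \<Rightarrow> nat) \<Rightarrow> (real \<Rightarrow> complex) \<Rightarrow> real \<Rightarrow> ennreal" where
  "square_function \<Lambda> f x = ennreal_powr (\<Sum>j. ennreal ((cmod (LP_block \<Lambda> j f x))\<^sup>2)) (1 / 2)"

end

theory Submission
  imports Defs
begin

text \<open>
  Write \<open>d\<^sub>m(x) = \<Sum>\<^sub>k\<^sub><\<^sub>m e\<^sup>i\<^sup>k\<^sup>x\<close> and \<open>\<delta> = \<lambda> - 1\<close>.  The idea is to let \<open>\<Lambda>\<close> start as an arithmetic progression: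
  with \<open>R\<close> the integer part of \<open>1/(2\<delta>)\<close>, the multiples \<open>L, 2L, \<dots>, 2RL\<close> have consecutive
  ratios at least \<open>1 + 1/(2R) \<ge> \<lambda>\<close>, the smallest one being \<open>1 + 1/(2R - 1) < \<lambda>\<^sup>3\<close>; after \<open>2RL\<close> the
  sequence doubles.  If \<open>f\<close> is analytic with constant Fourier coefficient \<open>s\<close> on \<open>[RL, 2RL)\<close>, each of
  the \<open>R\<close> blocks in that range is \<open>s\<close> times a modulation of the same kernel \<open>d\<^sub>L\<close>, so that pointwise
  \<open>S(f) \<ge> \<surd>R |s| |d\<^sub>L|\<close> (lemmas \<open>norm_LP_block_analytic\<close> and \<open>square_function_ge\<close>).  The factor
  \<open>\<surd>R\<close> is the \<open>(\<lambda> - 1)\<^sup>-\<^sup>1\<^sup>/\<^sup>2\<close> of the theorem.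

  The factor \<open>1/(p - 1)\<close> is the logarithmic growth of the Lebesgue constants: the \<open>L\<^sup>1\<close> norm of \<open>d\<^sub>L\<close>
  is at least \<open>ln L / \<pi>\<close> (lemma \<open>circle_mean_geom_kernel_ge\<close>), and the \<open>L\<^sup>p\<close> norm dominates the
  \<open>L\<^sup>1\<close> norm.  For \<open>f\<close> take the normalised analytic trapezoid \<open>d\<^sub>a d\<^sub>2\<^sub>a / a\<close> with \<open>a = RL\<close>, an analogue of a
  de la Vallee-Poussin kernel, whose \<open>L\<^sup>1\<close> norm is bounded and whose sup norm is at most \<open>2RL\<close>;
  hence before normalisation its \<open>L\<^sup>p\<close> norm is \<open>O((2RL)\<^sup>p\<^sup>-\<^sup>1)\<close> (lemma \<open>circle_mean_trapezoid_le\<close>).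

  It remains to balance the parameters.  With \<open>L = R\<close> and \<open>p = 1 + 1/ln R\<close> one has
  \<open>(2RL)\<^sup>p\<^sup>-\<^sup>1 \<le> (R\<^sup>3)\<^sup>p\<^sup>-\<^sup>1 = e\<^sup>3\<close>, which is an absolute constant, while \<open>ln L = 1/(p - 1)\<close>.  As \<open>\<lambda>\<close> tends to
  \<open>1\<close>, \<open>R\<close> tends to infinity and \<open>p\<close> to \<open>1\<close>, whence the threshold \<open>\<lambda>\<^sub>\<epsilon>\<close>.
\<close>

section \<open>Exponentials and their Fourier coefficients\<close>

definition wave :: "int \<Rightarrow> real \<Rightarrow> complex" where
  "wave n x = exp (\<i> * of_int n * complex_of_real x)"

lemma wave_add: "wave (m + n) x = wave m x * wave n x"
  by (simp add: wave_def exp_add[symmetric] algebra_simps)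

lemma wave_minus: "wave (- n) x = cnj (wave n x)"
  by (simp add: wave_def exp_cnj)

lemma wave_zero [simp]: "wave 0 x = 1"
  by (simp add: wave_def)

lemma norm_wave [simp]: "norm (wave n x) = 1"
  by (simp add: wave_def norm_exp_eq_Re)

lemma wave_period: "wave n (x + 2 * pi) = wave n x"
proof -
  have "exp (of_int n * (2 * of_real pi * \<i>)) = 1"
    using exp_integer_2pi[of "of_int n"] by (simp add: algebra_simps)
  then show ?thesis
    by (simp add: wave_def distrib_left exp_add mult_ac)
qed

lemma wave_2pi: "wave n (2 * pi) = 1"
  using wave_period[of n 0] by (simp add: wave_def)

lemma continuous_on_wave [continuous_intros]: "continuous_on S (wave n)"
  unfolding wave_def by (intro continuous_intros)

lemma has_vector_derivative_wave:
  "(wave n has_vector_derivative \<i> * of_int n * wave n x) (at x within S)"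
  unfolding wave_def
  by (auto intro!: derivative_eq_intros has_vector_derivative_real_field simp: field_simps)

lemma has_integral_wave:
  "(wave n has_integral (if n = 0 then of_real (2 * pi) else 0)) {0..2 * pi}"
proof (cases "n = 0")
  case True
  have "((\<lambda>x::real. 1::complex) has_integral ((2 * pi) *\<^sub>R 1)) {0..2*pi}"
    using has_integral_const_real[of "1::complex" 0 "2 * pi"] by simp
  moreover have "wave 0 = (\<lambda>x. 1)" by (rule ext) simp
  ultimately show ?thesis using True by (simp add: scaleR_conv_of_real)
next
  case False
  have "((\<lambda>x. wave n x) has_integral
      (wave n (2 * pi) / (\<i> * of_int n) - wave n 0 / (\<i> * of_int n))) {0..2 * pi}"
    by (rule fundamental_theorem_of_calculus)
       (use False in \<open>auto intro!: derivative_eq_intros has_vector_derivative_wave\<close>)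
  then show ?thesis using False wave_2pi[of n] by (simp add: wave_def[of n 0])
qed

text \<open>
  Up to a unimodular constant, the sawtooth \<open>\<pi> - x\<close> has the coefficients \<open>1/n\<close>.  Pairing with it turns a sum of
  exponentials with positive frequencies into a harmonic sum.
\<close>
lemma has_integral_sawtooth_wave:
  "((\<lambda>x. of_real (pi - x) * wave n x) has_integral
     (if n = 0 then 0 else 2 * pi * \<i> / of_int n)) {0..2 * pi}"
proof (cases "n = 0")
  case True
  have "((\<lambda>x. pi - x) has_integral
      ((pi * (2 * pi) - (2 * pi)\<^sup>2 / 2) - (pi * 0 - 0\<^sup>2 / 2))) {0..2 * pi}"
    by (rule fundamental_theorem_of_calculus)
       (auto intro!: derivative_eq_intros simp: has_real_derivative_iff_has_vector_derivative[symmetric])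
  then have "((\<lambda>x. pi - x) has_integral 0) {0..2 * pi}" by (simp add: power2_eq_square)
  then have "((\<lambda>x. complex_of_real (pi - x)) has_integral of_real 0) {0..2 * pi}"
    by (rule has_integral_of_real)
  then show ?thesis using True by simp
next
  case False
  let ?F = "\<lambda>x. (of_real (pi - x) * wave n x + wave n x / (\<i> * of_int n)) / (\<i> * of_int n)"
  have "((\<lambda>x. of_real (pi - x) * wave n x) has_integral (?F (2 * pi) - ?F 0)) {0..2 * pi}"
    by (rule fundamental_theorem_of_calculus)
       (use False in \<open>auto intro!: derivative_eq_intros has_vector_derivative_wave
          simp: field_simps\<close>)
  moreover have "?F (2 * pi) - ?F 0 = 2 * pi * \<i> / of_int n"
    using False wave_2pi[of n] by (simp add: wave_def field_simps)
  ultimately show ?thesis using False by simp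
qed

lemma fourier_coeff_wave_sum:
  assumes "finite I"
  shows "fourier_coeff (\<lambda>x. \<Sum>i\<in>I. c i * wave (n i) x) m = (\<Sum>i\<in>I. if n i = m then c i else 0)"
proof -
  have e: "(\<Sum>i\<in>I. c i * wave (n i) x) * exp (- (\<i> * of_int m * of_real x)) =
      (\<Sum>i\<in>I. c i * wave (n i - m) x)" for x
  proof -
    have "exp (- (\<i> * of_int m * of_real x)) = wave (- m) x" by (simp add: wave_def)
    then show ?thesis by (simp add: sum_distrib_right mult.assoc flip: wave_add)
  qed
  have "((\<lambda>x. \<Sum>i\<in>I. c i * wave (n i - m) x) has_integral
      (\<Sum>i\<in>I. c i * (if n i - m = 0 then of_real (2 * pi) else 0))) {0..2 * pi}"
    by (intro has_integral_sum assms has_integral_mult_right has_integral_wave)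
  moreover have "(LINT x:{0..2*pi}|lebesgue. (\<Sum>i\<in>I. c i * wave (n i - m) x)) =
      integral {0..2*pi} (\<lambda>x. \<Sum>i\<in>I. c i * wave (n i - m) x)"
    by (intro set_lebesgue_integral_eq_integral absolutely_integrable_continuous_real continuous_intros)
  ultimately show ?thesis
    unfolding fourier_coeff_def e
    by (auto simp: integral_unique sum_distrib_left intro!: sum.cong)
qed

section \<open>Means and norms of continuous functions on the circle\<close>

definition circle_mean :: "(real \<Rightarrow> real) \<Rightarrow> real" where
  "circle_mean h = integral {0..2 * pi} h / (2 * pi)"

lemma circle_mean_mono:
  assumes "continuous_on UNIV g" "continuous_on UNIV h" "\<And>x. g x \<le> h x"
  shows "circle_mean g \<le> circle_mean h"
  unfolding circle_mean_def
  by (intro divide_right_mono integral_le integrable_continuous_real)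
     (use assms in \<open>auto intro: continuous_on_subset\<close>)

lemma circle_mean_add:
  assumes "continuous_on UNIV g" "continuous_on UNIV h"
  shows "circle_mean (\<lambda>x. g x + h x) = circle_mean g + circle_mean h"
  unfolding circle_mean_def
  by (subst integral_add)
     (use assms in \<open>auto intro!: integrable_continuous_real intro: continuous_on_subset simp: add_divide_distrib\<close>)

lemma circle_mean_cmult: "circle_mean (\<lambda>x. c * h x) = c * circle_mean h"
  unfolding circle_mean_def by simp

lemma circle_mean_one: "circle_mean (\<lambda>x. 1) = 1"
  unfolding circle_mean_def by simp

lemma circle_mean_nonneg:
  assumes "continuous_on UNIV h" "\<And>x. 0 \<le> h x"
  shows "0 \<le> circle_mean h"
  using circle_mean_mono[of "\<lambda>x. 0" h] assms by (simp add: circle_mean_def)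

text \<open>
  For continuous functions the extended-valued norm is an ordinary Riemann integral, so all
  estimates below can be made with real numbers.
\<close>
lemma circle_Lp_norm_continuous:
  fixes h :: "real \<Rightarrow> real"
  assumes "continuous_on UNIV h" "\<And>x. 0 \<le> h x" "p > 0"
  shows "circle_Lp_norm p (\<lambda>x. ennreal (h x)) = ennreal (circle_mean (\<lambda>x. h x powr p) powr (1 / p))"
proof -
  let ?g = "\<lambda>x. h x powr p"
  have c: "continuous_on UNIV ?g"
    using assms by (intro continuous_on_powr') (auto intro!: continuous_intros)
  have i: "(?g has_integral integral {0..2*pi} ?g) {0..2*pi}"
    by (intro integrable_integral integrable_continuous_real continuous_on_subset[OF c]) auto
  have n: "integral {0..2*pi} ?g \<ge> 0"
    by (intro integral_nonneg has_integral_integrable[OF i]) simp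
  have p: "ennreal_powr (ennreal (h x)) p = ennreal (?g x)" for x
    using assms by (simp add: ennreal_powr_def)
  have "(\<integral>\<^sup>+x\<in>{0..2*pi}. ennreal (?g x) \<partial>lebesgue) = ennreal (integral {0..2*pi} ?g)"
    using nn_integral_has_integral_lebesgue'[OF _ i] by (simp add: nn_integral_completion)
  then show ?thesis
    using n unfolding circle_Lp_norm_def p
    by (simp add: ennreal_mult[symmetric] ennreal_powr_def circle_mean_def)
qed

lemma ennreal_powr_mono:
  assumes "x \<le> y" "0 \<le> a"
  shows "ennreal_powr x a \<le> ennreal_powr y a"
  using assms
  by (cases x; cases y) (auto simp: ennreal_powr_def top_unique intro!: ennreal_leI powr_mono2)

lemma circle_Lp_norm_mono:
  assumes "\<And>x. g x \<le> h x" "p > 0"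
  shows "circle_Lp_norm p g \<le> circle_Lp_norm p h"
  unfolding circle_Lp_norm_def using assms
  by (intro ennreal_powr_mono mult_left_mono nn_integral_mono mult_right_mono) auto

text \<open>
  Jensen's inequality up to a factor \<open>2\<close>, which is harmless here.  It follows from
  \<open>t \<le> 1 + t\<^sup>p\<close> alone: rescaling \<open>h\<close> to have mean \<open>2\<close>, the mean of \<open>h\<^sup>p\<close> is at least \<open>1\<close>.
\<close>
lemma circle_mean_le_Lp_norm:
  fixes h :: "real \<Rightarrow> real"
  assumes h: "continuous_on UNIV h" "\<And>x. 0 \<le> h x" and p: "p \<ge> 1"
  shows "circle_mean h / 2 \<le> circle_mean (\<lambda>x. h x powr p) powr (1 / p)"
proof (cases "circle_mean h = 0")
  case False
  define A where "A = circle_mean h / 2"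
  have A: "A > 0" using False circle_mean_nonneg[OF h] by (simp add: A_def)
  have c: "continuous_on UNIV (\<lambda>x. h x powr p)"
    using h p by (intro continuous_on_powr') (auto intro!: continuous_intros)
  have pt: "h x / A \<le> 1 + h x powr p / A powr p" for x
  proof (cases "h x \<le> A")
    case True
    then have "h x / A \<le> 1" using A by simp
    moreover have "0 \<le> h x powr p / A powr p" by simp
    ultimately show ?thesis by linarith
  next
    case False
    then have "(h x / A) powr 1 \<le> (h x / A) powr p"
      using A p by (intro powr_mono) auto
    then show ?thesis using A h(2)[of x] False by (simp add: powr_divide)
  qed
  have "2 = circle_mean (\<lambda>x. (1 / A) * h x)"
    using A by (subst circle_mean_cmult) (simp add: A_def)
  also have "\<dots> \<le> circle_mean (\<lambda>x. 1 + (1 / A powr p) * h x powr p)"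
    using pt by (intro circle_mean_mono continuous_intros h c) simp
  also have "\<dots> = 1 + circle_mean (\<lambda>x. h x powr p) / A powr p"
    using circle_mean_add[OF continuous_on_const continuous_on_mult_left[OF c], of 1 "1 / A powr p"]
      circle_mean_cmult[of "1 / A powr p" "\<lambda>x. h x powr p"]
    by (simp add: circle_mean_one)
  finally have "1 \<le> circle_mean (\<lambda>x. h x powr p) / A powr p" by simp
  then have "A powr p \<le> circle_mean (\<lambda>x. h x powr p)" using A by (simp add: field_simps)
  then have "(A powr p) powr (1 / p) \<le> circle_mean (\<lambda>x. h x powr p) powr (1 / p)"
    using p by (intro powr_mono2) auto
  then show ?thesis using A p by (simp add: powr_powr A_def)
qed simp

section \<open>One-sided Dirichlet kernels\<close>

definition geom_kernel :: "nat \<Rightarrow> real \<Rightarrow> complex" where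
  "geom_kernel m x = (\<Sum>k<m. wave (int k) x)"

lemma continuous_on_geom_kernel [continuous_intros]: "continuous_on S (geom_kernel m)"
  unfolding geom_kernel_def by (intro continuous_intros)

lemma norm_geom_kernel_le: "cmod (geom_kernel m x) \<le> real m"
  unfolding geom_kernel_def by (rule order_trans[OF norm_sum]) simp

text \<open>Parseval's identity for the kernel.\<close>
lemma circle_mean_geom_kernel_square: "circle_mean (\<lambda>x. (cmod (geom_kernel m x))\<^sup>2) = real m"
proof -
  have e: "complex_of_real ((cmod (geom_kernel m x))\<^sup>2) = (\<Sum>k<m. \<Sum>l<m. wave (int k - int l) x)" for x
  proof -
    have "complex_of_real ((cmod (geom_kernel m x))\<^sup>2) = geom_kernel m x * cnj (geom_kernel m x)"
      by (rule complex_norm_square)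
    also have "\<dots> = (\<Sum>k<m. \<Sum>l<m. wave (int k - int l) x)"
      unfolding geom_kernel_def
      by (simp add: sum_product wave_minus[symmetric] wave_add[symmetric])
    finally show ?thesis .
  qed
  have "((\<lambda>x. \<Sum>k<m. \<Sum>l<m. wave (int k - int l) x) has_integral
      (\<Sum>k<m. \<Sum>l<m. if int k - int l = 0 then of_real (2 * pi) else 0)) {0..2 * pi}"
    by (intro has_integral_sum has_integral_wave) auto
  then have "((\<lambda>x. complex_of_real ((cmod (geom_kernel m x))\<^sup>2)) has_integral
      (of_real (2 * pi * real m))) {0..2 * pi}"
    unfolding e by (simp add: mult.commute)
  then have "((\<lambda>x. (cmod (geom_kernel m x))\<^sup>2) has_integral (2 * pi * real m)) {0..2 * pi}"
    by (drule_tac has_integral_linear[OF _ bounded_linear_Re]) (simp add: o_def del: of_real_power)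
  then show ?thesis by (simp add: circle_mean_def integral_unique)
qed

text \<open>
  The Lebesgue constants grow logarithmically.  As in Hardy's inequality, the kernel is tested
  against the sawtooth \<open>\<pi> - x\<close>, which is bounded by \<open>\<pi>\<close> on the period; the pairing is a harmonic sum.
\<close>
lemma circle_mean_geom_kernel_ge:
  assumes "m > 0"
  shows "ln (real m) / pi \<le> circle_mean (\<lambda>x. cmod (geom_kernel m x))"
proof -
  let ?I = "integral {0..2*pi} (\<lambda>x. of_real (pi - x) * geom_kernel m x)"
  have i: "((\<lambda>x. of_real (pi - x) * geom_kernel m x) has_integral
      (\<Sum>k<m. if int k = 0 then 0 else 2 * pi * \<i> / of_int (int k))) {0..2 * pi}"
    unfolding geom_kernel_def sum_distrib_left
    by (intro has_integral_sum has_integral_sawtooth_wave) auto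
  obtain q where q: "m = Suc q" using assms by (cases m) auto
  have "?I = (\<Sum>k<m. if int k = 0 then 0 else 2 * pi * \<i> / of_int (int k))"
    using i by (rule integral_unique)
  also have "\<dots> = (\<Sum>k=1..q. 2 * pi * \<i> / of_nat k)"
    unfolding q by (intro sum.mono_neutral_cong_right) auto
  also have "\<dots> = \<i> * of_real (2 * pi * harm q)"
    by (simp add: harm_def sum_distrib_left divide_inverse mult_ac)
  finally have I: "?I = \<i> * of_real (2 * pi * harm q)" .
  have "harm q \<ge> (0::real)" by (rule harm_nonneg)
  then have "2 * pi * harm q = norm ?I" unfolding I by (simp add: norm_mult)
  also have "\<dots> \<le> integral {0..2*pi} (\<lambda>x. pi * cmod (geom_kernel m x))"
    by (intro integral_norm_bound_integral)
       (auto simp: norm_mult simp flip: of_real_diff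
          intro!: mult_right_mono integrable_continuous_real continuous_intros)
  also have "\<dots> = 2 * pi * (pi * circle_mean (\<lambda>x. cmod (geom_kernel m x)))"
    by (simp add: circle_mean_def)
  finally have "harm q \<le> pi * circle_mean (\<lambda>x. cmod (geom_kernel m x))" by simp
  moreover have "ln (real m) \<le> harm q" using ln_le_harm[of q] by (simp add: q add.commute)
  ultimately show ?thesis by (simp add: divide_le_eq mult.commute)
qed

section \<open>Analytic trapezoidal kernels\<close>

text \<open>
  Convolving the indicators of \<open>[0, a)\<close> and \<open>[0, b)\<close> for \<open>a \<le> b\<close> gives a trapezoid with plateau
  \<open>[a - 1, b - 1]\<close>; the division by \<open>a\<close> makes the height of the plateau \<open>1\<close>.
\<close>
definition trapezoid :: "nat \<Rightarrow> nat \<Rightarrow> real \<Rightarrow> complex" where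
  "trapezoid a b x = geom_kernel a x * geom_kernel b x / of_nat a"

lemma continuous_on_trapezoid [continuous_intros]: "continuous_on S (trapezoid a b)"
proof (cases "a = 0")
  case False
  then show ?thesis unfolding trapezoid_def by (intro continuous_intros) auto
qed (simp add: trapezoid_def[abs_def])

lemma trapezoid_period: "trapezoid a b (x + 2 * pi) = trapezoid a b x"
  by (simp add: trapezoid_def geom_kernel_def wave_period)

lemma fourier_coeff_trapezoid:
  "fourier_coeff (\<lambda>x. c * trapezoid a b x) m =
     (\<Sum>k<a. \<Sum>l<b. if int k + int l = m then c / of_nat a else 0)"
proof -
  have "(\<lambda>x. c * trapezoid a b x) =
      (\<lambda>x. \<Sum>(k, l)\<in>{..<a} \<times> {..<b}. (c / of_nat a) * wave (int k + int l) x)"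
  proof
    fix x
    have "c * trapezoid a b x = (c / of_nat a) * (geom_kernel a x * geom_kernel b x)"
      by (simp add: trapezoid_def)
    then show "c * trapezoid a b x =
        (\<Sum>(k, l)\<in>{..<a} \<times> {..<b}. (c / of_nat a) * wave (int k + int l) x)"
      unfolding geom_kernel_def sum_product
      by (simp add: wave_add sum_distrib_left flip: sum.cartesian_product)
  qed
  then show ?thesis
    using fourier_coeff_wave_sum[of "{..<a} \<times> {..<b}" "\<lambda>_. c / of_nat a" "\<lambda>(k, l). int k + int l" m]
    by (simp add: case_prod_unfold sum.cartesian_product)
qed

lemma fourier_coeff_trapezoid_neg: "m < 0 \<Longrightarrow> fourier_coeff (\<lambda>x. c * trapezoid a b x) m = 0"
  by (auto simp: fourier_coeff_trapezoid intro!: sum.neutral)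

text \<open>
  On the plateau every \<open>k < a\<close> has exactly one partner \<open>l < b\<close> with \<open>k + l = n\<close>.
\<close>
lemma fourier_coeff_trapezoid_plateau:
  assumes "a > 0" "a \<le> n" "n < b"
  shows "fourier_coeff (\<lambda>x. c * trapezoid a b x) (int n) = c"
proof -
  have "(\<Sum>l<b. if int k + int l = int n then c / of_nat a else 0) = c / of_nat a" if "k < a" for k
  proof -
    have "(\<Sum>l<b. if int k + int l = int n then c / of_nat a else 0) =
        (\<Sum>l<b. if l = n - k then c / of_nat a else 0)"
      using that assms by (intro sum.cong) auto
    then show ?thesis using assms by (simp add: less_imp_diff_less)
  qed
  then show ?thesis using assms by (simp add: fourier_coeff_trapezoid)
qed

text \<open>
  Interpolation between \<open>L\<^sup>1\<close> and \<open>L\<^sup>\<infinity>\<close>: the sup norm is at most \<open>b\<close>, and the \<open>L\<^sup>1\<close> norm of the product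
  is controlled by the two \<open>L\<^sup>2\<close> norms, in the form \<open>2uv \<le> u\<^sup>2 + v\<^sup>2\<close>.
\<close>
lemma circle_mean_trapezoid_le:
  assumes a: "a > 0" and p: "p \<ge> 1"
  shows "circle_mean (\<lambda>x. cmod (trapezoid a b x) powr p)
    \<le> real b powr (p - 1) * ((real a + real b) / (2 * real a))"
proof -
  let ?A = "\<lambda>x. (cmod (geom_kernel a x))\<^sup>2" and ?B = "\<lambda>x. (cmod (geom_kernel b x))\<^sup>2"
  have pt: "cmod (trapezoid a b x) powr p
      \<le> (real b powr (p - 1) / (2 * real a)) * (?A x + ?B x)" for x
  proof -
    have n: "cmod (trapezoid a b x) = cmod (geom_kernel a x) * cmod (geom_kernel b x) / real a"
      by (simp add: trapezoid_def norm_mult norm_divide)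
    have "cmod (trapezoid a b x) \<le> real a * real b / real a"
      unfolding n by (intro divide_right_mono mult_mono norm_geom_kernel_le) auto
    then have 1: "cmod (trapezoid a b x) powr (p - 1) \<le> real b powr (p - 1)"
      using a p by (intro powr_mono2) auto
    have "2 * (cmod (geom_kernel a x) * cmod (geom_kernel b x)) \<le> ?A x + ?B x"
      using sum_squares_bound[of "cmod (geom_kernel a x)" "cmod (geom_kernel b x)"] by simp
    then have 2: "cmod (trapezoid a b x) \<le> (?A x + ?B x) / (2 * real a)"
      using a unfolding n by (simp add: field_simps)
    have "cmod (trapezoid a b x) powr p = cmod (trapezoid a b x) powr (p - 1) * cmod (trapezoid a b x)"
      using powr_add[of "cmod (trapezoid a b x)" "p - 1" 1] by simp
    also have "\<dots> \<le> real b powr (p - 1) * ((?A x + ?B x) / (2 * real a))"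
      using 1 2 by (intro mult_mono) auto
    finally show ?thesis by simp
  qed
  have cA: "continuous_on UNIV ?A" and cB: "continuous_on UNIV ?B"
    by (intro continuous_intros)+
  have "circle_mean (\<lambda>x. cmod (trapezoid a b x) powr p)
      \<le> circle_mean (\<lambda>x. (real b powr (p - 1) / (2 * real a)) * (?A x + ?B x))"
    using p a by (intro circle_mean_mono pt continuous_on_powr') (auto intro!: continuous_intros)
  also have "\<dots> = (real b powr (p - 1) / (2 * real a)) * (real a + real b)"
    by (subst circle_mean_cmult)
       (simp only: circle_mean_add[OF cA cB] circle_mean_geom_kernel_square)
  finally show ?thesis by simp
qed

lemma circle_mean_trapezoid_pos:
  assumes "a > 0" "b > 0" "p > 0"
  shows "circle_mean (\<lambda>x. cmod (trapezoid a b x) powr p) > 0"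
proof -
  let ?h = "\<lambda>x. cmod (trapezoid a b x) powr p"
  have c: "continuous_on UNIV ?h"
    using assms by (intro continuous_on_powr') (auto intro!: continuous_intros)
  have "?h 0 \<noteq> 0"
    using assms by (simp add: trapezoid_def geom_kernel_def wave_def)
  then have "integral {0..2 * pi} ?h \<noteq> 0"
    using integral_eq_0_iff[of 0 "2 * pi" ?h] continuous_on_subset[OF c] by fastforce
  then have "circle_mean ?h \<noteq> 0" by (simp add: circle_mean_def)
  moreover have "circle_mean ?h \<ge> 0" by (rule circle_mean_nonneg[OF c]) simp
  ultimately show ?thesis by simp
qed

section \<open>Littlewood-Paley blocks of analytic functions\<close>

lemma partial_sum_analytic:
  assumes "\<And>m. m < 0 \<Longrightarrow> fourier_coeff f m = 0"
  shows "partial_sum N f x = (\<Sum>n<N. fourier_coeff f (int n) * wave (int n) x)"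
proof -
  have "partial_sum N f x = (\<Sum>n\<in>int ` {..<N}. fourier_coeff f n * wave n x)"
    unfolding partial_sum_def wave_def[symmetric]
  proof (rule sum.mono_neutral_right)
    show "\<forall>i\<in>{- int N + 1..int N - 1} - int ` {..<N}. fourier_coeff f i * wave i x = 0"
    proof
      fix i assume i: "i \<in> {- int N + 1..int N - 1} - int ` {..<N}"
      have "i < 0"
      proof (rule ccontr)
        assume "\<not> i < 0"
        then have "i = int (nat i)" "nat i < N" using i by auto
        then show False using i by blast
      qed
      then show "fourier_coeff f i * wave i x = 0" using assms by simp
    qed
  qed auto
  also have "\<dots> = (\<Sum>n<N. fourier_coeff f (int n) * wave (int n) x)"
    by (simp add: sum.reindex)
  finally show ?thesis .
qed

text \<open>
  A block on which the coefficients are constant is a modulated Dirichlet kernel; its modulus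
  depends on the length of the block but not on its position.
\<close>
lemma norm_LP_block_analytic:
  assumes neg: "\<And>m. m < 0 \<Longrightarrow> fourier_coeff f m = 0"
    and step: "\<Lambda> (Suc j) = \<Lambda> j + L"
    and const: "\<And>n. \<Lambda> j \<le> n \<Longrightarrow> n < \<Lambda> (Suc j) \<Longrightarrow> fourier_coeff f (int n) = c"
  shows "cmod (LP_block \<Lambda> (Suc j) f x) = cmod c * cmod (geom_kernel L x)"
proof -
  let ?t = "\<lambda>n. fourier_coeff f (int n) * wave (int n) x"
  have "LP_block \<Lambda> (Suc j) f x = (\<Sum>n<\<Lambda> j + L. ?t n) - (\<Sum>n<\<Lambda> j. ?t n)"
    by (simp add: partial_sum_analytic[OF neg] step)
  also have "\<dots> = (\<Sum>k<L. ?t (\<Lambda> j + k))"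
    by (induction L) (auto simp: algebra_simps)
  also have "\<dots> = (\<Sum>k<L. c * (wave (int (\<Lambda> j)) x * wave (int k) x))"
  proof (intro sum.cong refl)
    fix k assume "k \<in> {..<L}"
    then have "fourier_coeff f (int (\<Lambda> j + k)) = c" using step by (intro const) auto
    then show "?t (\<Lambda> j + k) = c * (wave (int (\<Lambda> j)) x * wave (int k) x)"
      by (simp add: wave_add)
  qed
  also have "\<dots> = c * wave (int (\<Lambda> j)) x * geom_kernel L x"
    by (simp add: geom_kernel_def sum_distrib_left mult.assoc)
  finally show ?thesis by (simp add: norm_mult)
qed

lemma square_function_ge:
  assumes "finite J" "t \<ge> 0" "\<And>j. j \<in> J \<Longrightarrow> t \<le> cmod (LP_block \<Lambda> j f x)"
  shows "ennreal (sqrt (real (card J)) * t) \<le> square_function \<Lambda> f x"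
proof -
  have "ennreal (real (card J) * t\<^sup>2) = (\<Sum>j\<in>J. ennreal (t\<^sup>2))"
    by (simp add: ennreal_mult ennreal_of_nat_eq_real_of_nat)
  also have "\<dots> \<le> (\<Sum>j\<in>J. ennreal ((cmod (LP_block \<Lambda> j f x))\<^sup>2))"
    using assms by (intro sum_mono ennreal_leI power_mono) auto
  also have "\<dots> \<le> (\<Sum>j. ennreal ((cmod (LP_block \<Lambda> j f x))\<^sup>2))"
    using assms by (intro sum_le_suminf) auto
  finally have "ennreal_powr (ennreal (real (card J) * t\<^sup>2)) (1 / 2) \<le> square_function \<Lambda> f x"
    unfolding square_function_def by (rule ennreal_powr_mono) simp
  then show ?thesis
    using assms by (simp add: ennreal_powr_def powr_half_sqrt real_sqrt_mult)
qed

text \<open>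
  The extremal function is the normalised trapezoid whose plateau covers the blocks \<open>R, \<dots>, 2R - 1\<close>.
  The normalising constant \<open>N = M\<^sup>1\<^sup>/\<^sup>p\<close> is bounded by the bound \<open>2(2a)\<^sup>p\<^sup>-\<^sup>1\<close> of \<open>M\<close> itself, which is
  possible because that bound is at least \<open>1\<close>.
\<close>
lemma exists_extremal_analytic:
  assumes R: "R > 0" and L: "L > 0" and p: "p \<ge> 1"
    and \<Lambda>: "\<And>j. j < 2 * R \<Longrightarrow> \<Lambda> j = (j + 1) * L"
  shows "\<exists>f\<in>analytic_Hardy p. circle_Lp_norm p (modulus f) = 1 \<and>
    ennreal (sqrt (real R) * ln (real L) / (4 * pi * real (2 * R * L) powr (p - 1)))
      \<le> circle_Lp_norm p (square_function \<Lambda> f)"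
proof -
  define a where "a = R * L"
  define N where "N = circle_mean (\<lambda>x. cmod (trapezoid a (2 * a) x) powr p) powr (1 / p)"
  define f where "f = (\<lambda>x. of_real (1 / N) * trapezoid a (2 * a) x)"
  have a: "a > 0" using R L by (simp add: a_def)
  let ?M = "circle_mean (\<lambda>x. cmod (trapezoid a (2 * a) x) powr p)"
  have M: "?M > 0" using a p by (intro circle_mean_trapezoid_pos) auto
  have N: "N > 0" using M by (simp add: N_def)
  have ge1: "1 \<le> real (2 * a) powr (p - 1)" using a p by (intro ge_one_powr_ge_zero) auto
  have "?M \<le> real (2 * a) powr (p - 1) * (3 / 2)"
    using circle_mean_trapezoid_le[of a p "2 * a"] a p by simp
  also have "\<dots> \<le> 2 * real (2 * a) powr (p - 1)" by simp
  finally have M2: "?M \<le> 2 * real (2 * a) powr (p - 1)" .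
  have "N \<le> (2 * real (2 * a) powr (p - 1)) powr (1 / p)"
    unfolding N_def using M M2 p by (intro powr_mono2) auto
  also have "\<dots> \<le> (2 * real (2 * a) powr (p - 1)) powr 1"
    using ge1 p by (intro powr_mono) auto
  finally have N2: "N \<le> 2 * real (2 * a) powr (p - 1)" using a by simp

  have cf: "continuous_on UNIV f" unfolding f_def by (intro continuous_intros)
  have nf: "cmod (f x) = 1 / N * cmod (trapezoid a (2 * a) x)" for x
    using N by (simp add: f_def norm_mult norm_divide)
  have Np: "N powr p = ?M" using M p by (simp add: N_def powr_powr)
  have "circle_mean (\<lambda>x. cmod (f x) powr p) =
      circle_mean (\<lambda>x. 1 / N powr p * cmod (trapezoid a (2 * a) x) powr p)"
    using N by (simp add: nf powr_divide)
  also have "\<dots> = 1" using M Np by (subst circle_mean_cmult) simp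
  finally have one: "circle_Lp_norm p (modulus f) = 1"
    using cf p by (subst circle_Lp_norm_continuous) (auto intro!: continuous_intros)
  have meas: "f \<in> borel_measurable lebesgue"
    using borel_measurable_continuous_onI[OF cf] by (simp add: measurable_completion)
  have neg: "fourier_coeff f m = 0" if "m < 0" for m
    using that unfolding f_def by (rule fourier_coeff_trapezoid_neg)
  have Hardy: "f \<in> analytic_Hardy p"
    unfolding analytic_Hardy_def circle_Lp_def circle_fun_def
  proof (intro CollectI conjI allI subsetI)
    show "f (x + 2 * pi) = f x" for x by (simp add: f_def trapezoid_period)
    show "circle_Lp_norm p (modulus f) < top" by (simp add: one)
    show "n \<in> {0..}" if "n \<in> {n. fourier_coeff f n \<noteq> 0}" for n
      using neg[of n] that by fastforce
  qed (rule meas)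

  let ?h = "\<lambda>x. (sqrt (real R) / N) * cmod (geom_kernel L x)"
  have S: "ennreal (?h x) \<le> square_function \<Lambda> f x" for x
  proof -
    have "1 / N * cmod (geom_kernel L x) \<le> cmod (LP_block \<Lambda> j f x)" if j: "j \<in> {R..<2 * R}" for j
    proof -
      obtain i where i: "j = Suc i" using j R by (cases j) auto
      have "cmod (LP_block \<Lambda> (Suc i) f x) = cmod (complex_of_real (1 / N)) * cmod (geom_kernel L x)"
      proof (rule norm_LP_block_analytic[OF neg])
        show "\<Lambda> (Suc i) = \<Lambda> i + L" using i j by (simp add: \<Lambda>)
        fix n assume n: "\<Lambda> i \<le> n" "n < \<Lambda> (Suc i)"
        have "R * L \<le> j * L" "(j + 1) * L \<le> 2 * R * L"
          using j by (intro mult_right_mono; simp)+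
        then have "a \<le> n" "n < 2 * a" using n i j by (auto simp: \<Lambda> a_def)
        then show "fourier_coeff f (int n) = complex_of_real (1 / N)"
          using a unfolding f_def by (intro fourier_coeff_trapezoid_plateau) auto
      qed
      then show ?thesis using N i by (simp add: norm_divide)
    qed
    then show ?thesis
      using square_function_ge[of "{R..<2 * R}" "1 / N * cmod (geom_kernel L x)" \<Lambda> f x] N by simp
  qed
  have ch: "continuous_on UNIV ?h" by (intro continuous_intros)
  have h0: "0 \<le> ?h x" for x using N by simp
  have lnL: "ln (real L) \<ge> 0" using L by simp
  have "sqrt (real R) * ln (real L) / (4 * pi * real (2 * R * L) powr (p - 1)) =
      sqrt (real R) / (2 * real (2 * a) powr (p - 1)) * (ln (real L) / pi) / 2"
    by (simp add: a_def mult.assoc)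
  also have "\<dots> \<le> sqrt (real R) / N * (ln (real L) / pi) / 2"
    using a N N2 lnL by (intro divide_right_mono mult_right_mono divide_left_mono) auto
  also have "\<dots> \<le> sqrt (real R) / N * circle_mean (\<lambda>x. cmod (geom_kernel L x)) / 2"
    using N circle_mean_geom_kernel_ge[OF L] by (intro divide_right_mono mult_left_mono) auto
  also have "\<dots> = circle_mean ?h / 2" by (subst circle_mean_cmult) simp
  also have "\<dots> \<le> circle_mean (\<lambda>x. ?h x powr p) powr (1 / p)"
    by (rule circle_mean_le_Lp_norm[OF ch h0 p])
  finally have "ennreal (sqrt (real R) * ln (real L) / (4 * pi * real (2 * R * L) powr (p - 1)))
      \<le> circle_Lp_norm p (\<lambda>x. ennreal (?h x))"
    using p by (subst circle_Lp_norm_continuous[OF ch h0]) (auto intro: ennreal_leI)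
  also have "\<dots> \<le> circle_Lp_norm p (square_function \<Lambda> f)"
    using p by (intro circle_Lp_norm_mono S) auto
  finally show ?thesis using Hardy one by blast
qed

section \<open>Arithmetic progressions continued by doubling\<close>

text \<open>
  The multiples \<open>L, 2L, \<dots>, QL\<close> followed by \<open>2QL, 4QL, \<dots>\<close>; the truncated subtraction makes the power of
  \<open>2\<close> trivial as long as \<open>j < Q\<close>.
\<close>
definition arith_geom :: "nat \<Rightarrow> nat \<Rightarrow> nat \<Rightarrow> nat" where
  "arith_geom L Q j = min (j + 1) Q * L * 2 ^ (j + 1 - Q)"

lemma arith_geom_pos: "L > 0 \<Longrightarrow> Q > 0 \<Longrightarrow> arith_geom L Q j > 0"
  by (simp add: arith_geom_def)

lemma arith_geom_arith: "j < Q \<Longrightarrow> arith_geom L Q j = (j + 1) * L"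
  by (simp add: arith_geom_def)

lemma arith_geom_ratio_arith:
  assumes "L > 0" "Suc j < Q"
  shows "real (arith_geom L Q (Suc j)) / real (arith_geom L Q j) = 1 + 1 / real (j + 1)"
proof -
  have "real (arith_geom L Q (Suc j)) / real (arith_geom L Q j) =
      (real (j + 2) * real L) / (real (j + 1) * real L)"
    using assms by (simp only: arith_geom_arith Suc_lessD of_nat_mult) simp
  also have "\<dots> = real (j + 2) / real (j + 1)" using assms by simp
  finally show ?thesis by (simp add: field_simps)
qed

lemma arith_geom_ratio_ge:
  assumes "L > 0" "Q > 0"
  shows "1 + 1 / real Q \<le> real (arith_geom L Q (Suc j)) / real (arith_geom L Q j)"
proof (cases "Suc j < Q")
  case True
  have "real (arith_geom L Q (Suc j)) / real (arith_geom L Q j) = 1 + 1 / real (j + 1)"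
    using True assms by (intro arith_geom_ratio_arith)
  moreover have "1 / real Q \<le> 1 / real (j + 1)" using True by (intro divide_left_mono) auto
  ultimately show ?thesis by simp
next
  case False
  then have "arith_geom L Q (Suc j) = 2 * arith_geom L Q j"
    by (simp add: arith_geom_def Suc_diff_le min_def)
  then show ?thesis using assms arith_geom_pos[OF assms, of j] by simp
qed

text \<open>
  The ratios decrease along the progression, so the last step, from \<open>(Q - 1)L\<close> to \<open>QL\<close>, gives the upper
  bound.
\<close>
lemma ratio_arith_geom:
  assumes "L > 0" "Q \<ge> 2"
  shows "1 + 1 / real Q \<le> ratio (arith_geom L Q)" "ratio (arith_geom L Q) \<le> 1 + 1 / (real Q - 1)"
proof -
  show "1 + 1 / real Q \<le> ratio (arith_geom L Q)"
    unfolding ratio_def using assms by (intro cINF_greatest arith_geom_ratio_ge) auto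
  obtain q where q: "Q = q + 2" using assms(2) by (metis le_iff_add add.commute)
  have "ratio (arith_geom L Q) \<le> real (arith_geom L Q (Suc q)) / real (arith_geom L Q q)"
    unfolding ratio_def by (intro cINF_lower bdd_belowI[of _ 0]) auto
  also have "\<dots> = 1 + 1 / (real Q - 1)"
    using assms by (subst arith_geom_ratio_arith) (simp_all add: q)
  finally show "ratio (arith_geom L Q) \<le> 1 + 1 / (real Q - 1)" .
qed

lemma lacunary_arith_geom:
  assumes "L > 0" "Q \<ge> 2"
  shows "lacunary (arith_geom L Q)"
proof -
  have "arith_geom L Q j < arith_geom L Q (Suc j)" for j
  proof -
    have "1 < 1 + 1 / real Q" using assms by simp
    also have "\<dots> \<le> real (arith_geom L Q (Suc j)) / real (arith_geom L Q j)"
      using assms by (intro arith_geom_ratio_ge) auto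
    finally show ?thesis
      using assms arith_geom_pos[of L Q j] by (simp add: less_divide_eq split: if_splits)
  qed
  then have "strict_mono (arith_geom L Q)" by (simp add: strict_mono_Suc_iff)
  moreover have "1 < 1 + 1 / real Q" using assms by simp
  ultimately show ?thesis
    using assms less_le_trans[OF _ ratio_arith_geom(1)[OF assms]]
    by (auto simp: lacunary_def arith_geom_pos)
qed

section \<open>The lower bound\<close>

lemma powr_minus_half: "x > 0 \<Longrightarrow> (x::real) powr (- 1 / 2) = 1 / sqrt x"
  using powr_minus_divide[of x "1 / 2"] by (simp add: powr_half_sqrt)

text \<open>
  The threshold for \<open>\<lambda>\<close> guarantees \<open>R > e\<^sup>1\<^sup>/\<^sup>\<epsilon>\<close>, that is \<open>p - 1 < \<epsilon>\<close>, and \<open>R > 4 > e\<close>, hence \<open>p < 2\<close>.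
  The bound \<open>4\<close> also makes \<open>\<delta>\<close> small enough for the comparison of \<open>1/(2R - 1)\<close> with \<open>3\<delta>\<close>.
\<close>
lemma extremal_for_arith_geom:
  fixes \<epsilon> lam :: real
  assumes \<epsilon>: "\<epsilon> > 0" and lam: "1 < lam" "lam < 1 + 1 / (2 * (exp (1 / \<epsilon>) + 4))"
  obtains R :: nat and p :: real where
    "ratio (arith_geom R (2 * R)) \<in> {lam..<lam ^ 3}" "lacunary (arith_geom R (2 * R))"
    "p \<in> {1<..<2}" "p < 1 + \<epsilon>"
    "\<exists>f\<in>analytic_Hardy p. circle_Lp_norm p (modulus f) = 1 \<and>
       ennreal (1 / (8 * pi * exp 3) / (p - 1) * (lam - 1) powr (- 1 / 2))
         \<le> circle_Lp_norm p (square_function (arith_geom R (2 * R)) f)"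
proof -
  define \<delta> where "\<delta> = lam - 1"
  define R where "R = nat \<lfloor>1 / (2 * \<delta>)\<rfloor>"
  define p where "p = 1 + 1 / ln (real R)"
  have \<delta>: "\<delta> > 0" using lam by (simp add: \<delta>_def)
  have E: "exp (1 / \<epsilon>) > 1" using \<epsilon> by simp
  have "\<delta> * (2 * (exp (1 / \<epsilon>) + 4)) < 1"
    using lam E by (simp add: \<delta>_def field_simps)
  then have d1: "exp (1 / \<epsilon>) + 4 < 1 / (2 * \<delta>)" using \<delta> by (simp add: field_simps)
  have "real R = of_int \<lfloor>1 / (2 * \<delta>)\<rfloor>" using \<delta> by (simp add: R_def)
  then have R1: "real R \<le> 1 / (2 * \<delta>)" and R2: "1 / (2 * \<delta>) < real R + 1" by linarith+
  have R3: "exp (1 / \<epsilon>) < real R" "4 < real R" using d1 R2 E by linarith+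
  then have R0: "R > 0" by simp
  have "1 / \<epsilon> < ln (real R)" using R3 ln_less_cancel_iff[of "exp (1 / \<epsilon>)" "real R"] R0 by simp
  have "exp 1 < real R" using exp_le R3 by linarith
  then have ln1: "1 < ln (real R)" using ln_less_cancel_iff[of "exp 1" "real R"] R0 by simp
  have pe: "p < 1 + \<epsilon>"
    using \<open>1 / \<epsilon> < ln (real R)\<close> \<epsilon> ln1 by (simp add: p_def field_simps)
  have p: "p \<in> {1<..<2}" using ln1 by (simp add: p_def field_simps)

  have "1 / (2 * \<delta>) > 5" using d1 E by linarith
  then have d8: "10 * \<delta> < 1" using \<delta> by (simp add: field_simps)
  have "lam \<le> 1 + 1 / real (2 * R)"
    using R1 R0 \<delta> by (simp add: \<delta>_def field_simps)
  moreover have "1 + 1 / (real (2 * R) - 1) < lam ^ 3"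
  proof -
    have "1 < 3 * \<delta> * (1 / \<delta> - 3)" using d8 \<delta> by (simp add: field_simps)
    also have "\<dots> < 3 * \<delta> * (real (2 * R) - 1)"
      using R2 \<delta> by (intro mult_strict_left_mono) (auto simp: field_simps)
    finally have "1 / (real (2 * R) - 1) < 3 * \<delta>" using R3 by (simp add: field_simps)
    moreover have "lam ^ 3 = 1 + 3 * \<delta> + 3 * \<delta>\<^sup>2 + \<delta> ^ 3"
      by (simp add: \<delta>_def power2_eq_square power3_eq_cube algebra_simps)
    ultimately show ?thesis using \<delta> by (smt (verit) zero_less_power)
  qed
  ultimately have ratio: "ratio (arith_geom R (2 * R)) \<in> {lam..<lam ^ 3}"
    using ratio_arith_geom[of R "2 * R"] R0 by auto

  \<comment> \<open>The loss from the size of the spectrum is bounded because \<open>p - 1 = 1 / ln R\<close>.\<close>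
  have "real (2 * R * R) powr (p - 1) \<le> (real R ^ 3) powr (p - 1)"
    using R3 p by (intro powr_mono2) (auto simp: power3_eq_cube)
  also have "\<dots> = exp 3"
  proof -
    have "(real R ^ 3) powr (p - 1) = exp ((p - 1) * (3 * ln (real R)))"
      using R0 by (simp add: powr_def ln_realpow)
    also have "(p - 1) * (3 * ln (real R)) = 3" using ln1 by (simp add: p_def)
    finally show ?thesis .
  qed
  finally have pw: "real (2 * R * R) powr (p - 1) \<le> exp 3" .
  have "\<delta> powr (- 1 / 2) = sqrt (1 / \<delta>)"
    using \<delta> powr_minus_half[of \<delta>] by (simp add: real_sqrt_divide)
  also have "\<dots> \<le> sqrt (4 * real R)"
    using R2 R3 by (intro real_sqrt_le_mono) simp
  also have "\<dots> = 2 * sqrt (real R)" by (simp add: real_sqrt_mult)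
  finally have sq: "\<delta> powr (- 1 / 2) \<le> 2 * sqrt (real R)" .
  have "1 / (8 * pi * exp 3) / (p - 1) * (lam - 1) powr (- 1 / 2) =
      ln (real R) * \<delta> powr (- 1 / 2) / (8 * pi * exp 3)"
    by (simp add: p_def \<delta>_def)
  also have "\<dots> \<le> ln (real R) * (2 * sqrt (real R)) / (8 * pi * exp 3)"
    using ln1 sq by (intro divide_right_mono mult_left_mono) auto
  also have "\<dots> = sqrt (real R) * ln (real R) / (4 * pi * exp 3)" by simp
  also have "\<dots> \<le> sqrt (real R) * ln (real R) / (4 * pi * real (2 * R * R) powr (p - 1))"
    using ln1 pw R0 by (intro divide_left_mono mult_left_mono) auto
  finally have le: "1 / (8 * pi * exp 3) / (p - 1) * (lam - 1) powr (- 1 / 2)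
      \<le> sqrt (real R) * ln (real R) / (4 * pi * real (2 * R * R) powr (p - 1))" .
  have "\<exists>f\<in>analytic_Hardy p. circle_Lp_norm p (modulus f) = 1 \<and>
      ennreal (sqrt (real R) * ln (real R) / (4 * pi * real (2 * R * R) powr (p - 1)))
        \<le> circle_Lp_norm p (square_function (arith_geom R (2 * R)) f)"
    using R0 p by (intro exists_extremal_analytic arith_geom_arith) auto
  then have "\<exists>f\<in>analytic_Hardy p. circle_Lp_norm p (modulus f) = 1 \<and>
      ennreal (1 / (8 * pi * exp 3) / (p - 1) * (lam - 1) powr (- 1 / 2))
        \<le> circle_Lp_norm p (square_function (arith_geom R (2 * R)) f)"
    using order_trans[OF ennreal_leI[OF le]] by blast
  then show ?thesis
    using that ratio p pe lacunary_arith_geom[of R "2 * R"] R0 by auto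
qed

theorem mainTheorem2:
  shows "\<exists>c C :: real. c > 0 \<and> C > 0 \<and>
    (\<forall>\<epsilon>::real. \<epsilon> > 0 \<longrightarrow>
      (\<exists>lam_eps::real. lam_eps > 1 \<and>
        (\<forall>lam::real. lam \<in> {1<..<lam_eps} \<longrightarrow>
          (\<exists>(\<Lambda> :: nat \<Rightarrow> nat) (p :: real).
             lacunary \<Lambda> \<and> ratio \<Lambda> \<in> {lam..<lam ^ 3} \<and>
             p \<in> {1<..<2} \<and> p < 1 + \<epsilon> \<and>
             (SUP f \<in> {f \<in> analytic_Hardy p. circle_Lp_norm p (modulus f) = 1}.
                circle_Lp_norm p (square_function \<Lambda> f))
               \<ge> ennreal (c / (p - 1) * (lam - 1) powr (- 1 / 2)) \<and>
             inverse C * (ratio \<Lambda> - 1) powr (- 1 / 2) \<le> (lam - 1) powr (- 1 / 2) \<and>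
             (lam - 1) powr (- 1 / 2) \<le> C * (ratio \<Lambda> - 1) powr (- 1 / 2)))))"
proof (rule exI[of _ "1 / (8 * pi * exp 3)"], rule exI[of _ "3::real"], intro conjI allI impI)
  fix \<epsilon> :: real assume \<epsilon>: "\<epsilon> > 0"
  define m where "m = 1 + 1 / (2 * (exp (1 / \<epsilon>) + 4))"
  have E: "exp (1 / \<epsilon>) > 0" by simp
  have m: "1 < m" "m < 2" using E by (simp_all add: m_def field_simps add_pos_pos)
  show "\<exists>lam_eps::real. lam_eps > 1 \<and>
        (\<forall>lam::real. lam \<in> {1<..<lam_eps} \<longrightarrow>
          (\<exists>(\<Lambda> :: nat \<Rightarrow> nat) (p :: real).
             lacunary \<Lambda> \<and> ratio \<Lambda> \<in> {lam..<lam ^ 3} \<and>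
             p \<in> {1<..<2} \<and> p < 1 + \<epsilon> \<and>
             (SUP f \<in> {f \<in> analytic_Hardy p. circle_Lp_norm p (modulus f) = 1}.
                circle_Lp_norm p (square_function \<Lambda> f))
               \<ge> ennreal (1 / (8 * pi * exp 3) / (p - 1) * (lam - 1) powr (- 1 / 2)) \<and>
             inverse 3 * (ratio \<Lambda> - 1) powr (- 1 / 2) \<le> (lam - 1) powr (- 1 / 2) \<and>
             (lam - 1) powr (- 1 / 2) \<le> 3 * (ratio \<Lambda> - 1) powr (- 1 / 2)))"
  proof (rule exI[of _ m], intro conjI allI impI)
    fix lam :: real assume "lam \<in> {1<..<m}"
    then have lam: "1 < lam" "lam < m" "lam < 2" using m by auto
    obtain R p where *:
      "ratio (arith_geom R (2 * R)) \<in> {lam..<lam ^ 3}" "lacunary (arith_geom R (2 * R))"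
      "p \<in> {1<..<2}" "p < 1 + \<epsilon>"
      "\<exists>f\<in>analytic_Hardy p. circle_Lp_norm p (modulus f) = 1 \<and>
         ennreal (1 / (8 * pi * exp 3) / (p - 1) * (lam - 1) powr (- 1 / 2))
           \<le> circle_Lp_norm p (square_function (arith_geom R (2 * R)) f)"
      using extremal_for_arith_geom[OF \<epsilon> lam(1) lam(2)[unfolded m_def]] by blast
    let ?\<Lambda> = "arith_geom R (2 * R)"
    let ?r = "ratio ?\<Lambda> - 1"
    \<comment> \<open>As \<open>\<lambda> < 2\<close>, the ratio minus one is at most \<open>9 (\<lambda> - 1)\<close>, and \<open>C = 3\<close> is the square root of \<open>9\<close>.\<close>
    have "lam ^ 3 - 1 = (lam - 1) * (lam\<^sup>2 + lam + 1)"
      by (simp add: power2_eq_square power3_eq_cube algebra_simps)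
    also have "\<dots> \<le> (lam - 1) * 9"
      using lam power_mono[of lam 2 2] by (intro mult_left_mono) auto
    finally have r: "lam - 1 \<le> ?r" "?r \<le> 9 * (lam - 1)" using *(1) by auto
    have "?r powr (- 1 / 2) \<le> (lam - 1) powr (- 1 / 2)"
      using r lam by (intro powr_mono2') auto
    moreover have "inverse 3 * ?r powr (- 1 / 2) \<le> ?r powr (- 1 / 2)"
      by (intro mult_left_le_one_le) auto
    ultimately have c1: "inverse 3 * ?r powr (- 1 / 2) \<le> (lam - 1) powr (- 1 / 2)" by linarith
    have "(9::real) powr (- 1 / 2) = 1 / 3"
      using powr_minus_half[of 9] real_sqrt_abs[of 3] by simp
    then have "(lam - 1) powr (- 1 / 2) = 3 * (9 * (lam - 1)) powr (- 1 / 2)"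
      using lam powr_mult[of 9 "lam - 1" "- 1 / 2"] by simp
    also have "\<dots> \<le> 3 * ?r powr (- 1 / 2)"
      using r lam by (intro mult_left_mono powr_mono2') auto
    finally have c2: "(lam - 1) powr (- 1 / 2) \<le> 3 * ?r powr (- 1 / 2)" .
    have "ennreal (1 / (8 * pi * exp 3) / (p - 1) * (lam - 1) powr (- 1 / 2))
      \<le> (SUP f \<in> {f \<in> analytic_Hardy p. circle_Lp_norm p (modulus f) = 1}.
                circle_Lp_norm p (square_function ?\<Lambda> f))"
      using *(5) by (auto intro: SUP_upper2)
    then show "\<exists>(\<Lambda> :: nat \<Rightarrow> nat) (p :: real).
             lacunary \<Lambda> \<and> ratio \<Lambda> \<in> {lam..<lam ^ 3} \<and>
             p \<in> {1<..<2} \<and> p < 1 + \<epsilon> \<and>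
             (SUP f \<in> {f \<in> analytic_Hardy p. circle_Lp_norm p (modulus f) = 1}.
                circle_Lp_norm p (square_function \<Lambda> f))
               \<ge> ennreal (1 / (8 * pi * exp 3) / (p - 1) * (lam - 1) powr (- 1 / 2)) \<and>
             inverse 3 * (ratio \<Lambda> - 1) powr (- 1 / 2) \<le> (lam - 1) powr (- 1 / 2) \<and>
             (lam - 1) powr (- 1 / 2) \<le> 3 * (ratio \<Lambda> - 1) powr (- 1 / 2)"
      using * c1 c2 by blast
  qed (use m in simp)
qed simp_all

end
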